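(* Let $K$ be a field, let $J_1,\ldots,J_s$ ($s\ge 1$) be monomial ideals of $K[x_1,\ldots,x_n]$, let $I=J_1\cap\cdots\cap J_s$, and for each integer $m\geq 1$ set $I_m=J_1^m\cap\cdots\cap J_s^m$. Then the limiting body of the graded family $\mathcal{I}=\{I_m\}_{m\ge 1}$, $$\mathcal{C}(\mathcal{I})=\bigcup_{m\geq 1}\frac{1}{m}NP(I_m),$$ is a polyhedron, and $$\mathcal{C}(\mathcal{I})=NP(J_1)\cap\cdots\cap NP(J_s).$$
   Context: For $\mathbf{a}\in\mathbb{N}^n$ (with $\mathbb{N}$ the nonnegative integers) write $\mathbf{x}^{\mathbf{a}}=x_1^{a_1}\cdots x_n^{a_n}$. A monomial ideal is an ideal generated by monomials. For a monomial ideal $J$, the Newton polyhedron $NP(J)\subseteq \mathbb{R}^n$ is the convex hull of $\{\mathbf{a}\in\mathbb{N}^n\mid \mathbf{x}^{\mathbf{a}}\in J\}$. A polyhedron is a finite intersection of closed half spaces of $\mathbb{R}^n$ (possibly unbounded). A graded family of ideals is a collection $\{I_m\}_{m\ge1}$ with $I_aI_b\subseteq I_{a+b}$ for all $a,b$. For $c>0$ and $S\subseteq\mathbb{R}^n$, $cS=\{c\mathbf{y}\mid \mathbf{y}\in S\}$. *)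

theory Defs
  imports "HOL-Analysis.Analysis" "HOL-Algebra.Algebraic_Closure_Type" "HOL-Algebra.Ideal_Product"
    "HOL-Library.Poly_Mapping"
begin

type_synonym ('n, 'k) mpoly = "('n \<Rightarrow>\<^sub>0 nat) \<Rightarrow>\<^sub>0 'k"

text \<open>The polynomial ring over the field \<open>'k\<close>, with one variable for each element of the
  finite type \<open>'n\<close>. The ring structure on the type is that of \<^theory>\<open>HOL-Library.Poly_Mapping\<close>;
  it is turned into a record in order to use the ideals of HOL-Algebra.\<close>

definition mpoly_ring :: "('n::finite, 'k::field) mpoly ring"
  where "mpoly_ring = ring_of_type_algebra"

definition monomial :: "('n::finite \<Rightarrow>\<^sub>0 nat) \<Rightarrow> ('n, 'k::field) mpoly"
  where "monomial a = Poly_Mapping.single a 1"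

definition monomial_ideal :: "('n::finite, 'k::field) mpoly set \<Rightarrow> bool"
  where "monomial_ideal J \<longleftrightarrow> (\<exists>A. J = genideal mpoly_ring (monomial ` A))"

text \<open>Powers are taken in the multiplicative monoid of ideals, so the product is the product
  of ideals and the zeroth power is the whole ring.\<close>

definition ideal_power :: "('n::finite, 'k::field) mpoly set \<Rightarrow> nat \<Rightarrow> ('n, 'k) mpoly set"
  where "ideal_power J m = J [^]\<^bsub>ideals_set mpoly_ring\<^esub> m"

definition exponent_vector :: "('n::finite \<Rightarrow>\<^sub>0 nat) \<Rightarrow> real ^ 'n"
  where "exponent_vector a = (\<chi> i. real (Poly_Mapping.lookup a i))"

definition newton_polyhedron :: "('n::finite, 'k::field) mpoly set \<Rightarrow> (real ^ 'n) set"
  where "newton_polyhedron J = convex hull (exponent_vector ` {a. monomial a \<in> J})"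

text \<open>Families are indexed by all natural numbers, but the value at 0 is irrelevant.\<close>

definition graded_family :: "(nat \<Rightarrow> ('n::finite, 'k::field) mpoly set) \<Rightarrow> bool"
  where "graded_family I \<longleftrightarrow>
    (\<forall>m\<ge>1. ideal (I m) mpoly_ring) \<and>
    (\<forall>a\<ge>1. \<forall>b\<ge>1. ideal_prod mpoly_ring (I a) (I b) \<subseteq> I (a + b))"

definition limiting_body :: "(nat \<Rightarrow> ('n::finite, 'k::field) mpoly set) \<Rightarrow> (real ^ 'n) set"
  where "limiting_body I =
    (\<Union>m\<in>{1..}. (\<lambda>y. (1 / real m) *\<^sub>R y) ` newton_polyhedron (I m))"

end

theory Submission
  imports Defs
begin

text \<open>
  A monomial of \<open>J\<^sup>m\<close> is divisible by a product of \<open>m\<close> monomials of \<open>J\<close>, so its exponent vector lies in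
  \<open>m\<close> times the Newton polyhedron of \<open>J\<close>; this gives one inclusion.
  For the other one, write a point \<open>y\<close> of the intersection, for each \<open>i\<close>, as a convex combination of
  exponent vectors of \<open>J\<^sub>i\<close> with real coefficients \<open>u\<^sub>i\<^sub>,\<^sub>v\<close>. An additive map \<open>f\<close> from the reals to the
  reals that sends \<open>1\<close> and all \<open>u\<^sub>i\<^sub>,\<^sub>v\<close> to natural numbers turns these combinations into integral
  ones, so that \<open>f(y)\<close>, taken coordinatewise, is the exponent vector of a monomial in all
  \<open>J\<^sub>i\<close> to the power \<open>f(1)\<close>, and \<open>f(y) / f(1)\<close> lies in the limiting body. On a given finite set of
  nonnegative reals the identity is a positive combination of such maps: in coordinates with
  respect to a basis of its rational span, the identity lies inside a small box with rational
  corners. Since the limiting body is convex, it contains \<open>y\<close>. This replaces the rationality of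
  the vertices of the intersection.
  Finally, Newton polyhedra are polyhedra because, by Dickson's lemma, each of them is the sum of a
  polytope and the nonnegative orthant, which has only finitely many faces.
\<close>

section \<open>Additive maps with natural values\<close>

lemma finite_common_denominator:
  fixes f :: "'a \<Rightarrow> real"
  assumes "finite V" "\<And>x. x \<in> V \<Longrightarrow> f x \<in> \<rat>"
  shows "\<exists>N::nat. N > 0 \<and> (\<forall>x\<in>V. real N * f x \<in> \<int>)"
  using assms
proof (induction V rule: finite_induct)
  case empty
  then show ?case by (auto intro: exI[of _ 1])
next
  case (insert x V)
  then obtain N where N: "N > 0" "\<forall>y\<in>V. real N * f y \<in> \<int>"
    by auto
  from insert.prems[of x] obtain p :: int and q :: nat where q: "q > 0" "f x = real_of_int p / real q"
    by (metis Rats_cases' insertI1 of_int_of_nat_eq pos_int_cases)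
  have "real q * f x \<in> \<int>"
    using q by simp
  then have "real N * (real q * f x) \<in> \<int>"
    by (rule Ints_mult[OF Ints_of_nat])
  moreover have "real q * (real N * f y) \<in> \<int>" if "y \<in> V" for y
    using N(2) that by (blast intro: Ints_mult[OF Ints_of_nat])
  ultimately have "\<forall>y\<in>insert x V. real (N * q) * f y \<in> \<int>"
    by (auto simp: algebra_simps)
  then show ?case
    using N q by (intro exI[of _ "N * q"]) auto
qed

text \<open>The predicate \<open>D\<close> turns this into an induction rule: it stands for any
  class that contains the suitable natural-valued maps and is closed under positive combinations, so
  no combination has to be written out. Strict positivity in \<open>base\<close> makes
  \<open>f 1\<close> a legitimate divisor when \<open>1\<close> is in \<open>V\<close>. Additivity
  holds on all reals; natural values, positivity and the final equality concern \<open>V\<close>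
  only.\<close>

lemma identity_generated_by_additive_nat_maps:
  fixes V :: "real set" and D :: "(real \<Rightarrow> real) \<Rightarrow> bool"
  assumes fin: "finite V" and nonneg: "\<And>x. x \<in> V \<Longrightarrow> 0 \<le> x"
    and base: "\<And>f. Modules.additive f \<Longrightarrow> f ` V \<subseteq> \<nat> \<Longrightarrow> (\<And>x. x \<in> V \<Longrightarrow> 0 < x \<Longrightarrow> 0 < f x) \<Longrightarrow> D f"
    and comb: "\<And>f g a b. D f \<Longrightarrow> D g \<Longrightarrow> 0 < a \<Longrightarrow> 0 < b \<Longrightarrow> D (\<lambda>x. a * f x + b * g x)"
  shows "\<exists>g. D g \<and> (\<forall>x\<in>V. g x = x)"
proof -
  interpret Q: vector_space "\<lambda>(q::rat) (x::real). of_rat q * x"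
    by unfold_locales (simp_all add: algebra_simps of_rat_add of_rat_mult)
  obtain B where B: "B \<subseteq> V" "Q.independent B" "V \<subseteq> Q.span B"
    using Q.maximal_independent_subset .
  have finB: "finite B"
    using B(1) fin finite_subset by blast
  \<comment> \<open>\<open>B\<close> is a basis of the rational span of \<open>V\<close>. Extending
    it to a Hamel basis of the reals makes the coordinates additive everywhere.\<close>
  obtain B' where B': "B \<subseteq> B'" "Q.independent B'" "Q.span B' = UNIV"
    by (metis Q.maximal_independent_subset_extend B(2) subset_UNIV top.extremum_uniqueI)
  define c where "c x b = real_of_rat (Q.representation B' x b)" for x b
  have c_add: "c (x + y) b = c x b + c y b" for x y b
    using Q.representation_add[OF B'(2), of y x] B'(3) by (simp add: c_def of_rat_add)
  have c_sum: "(\<Sum>b\<in>B. b * c x b) = x" if "x \<in> V" for x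
  proof -
    have "Q.representation B' x = Q.representation B x"
      using Q.representation_extend[OF B'(2) _ B'(1)] B(3) that by blast
    then show ?thesis
      using Q.sum_representation_eq[OF B(2) _ finB order_refl, of x] B(3) that
      by (auto simp: c_def mult.commute)
  qed
  \<comment> \<open>\<open>R \<beta>\<close> is the rational-linear map that sends each
    \<open>b\<close> in \<open>B\<close> to \<open>\<beta> b\<close> and kills
    \<open>B' - B\<close>; the choice \<open>\<beta> b = b\<close> gives the identity on
    \<open>V\<close>.\<close>
  define R where "R \<beta> x = (\<Sum>b\<in>B. \<beta> b * c x b)" for \<beta> x
  have R_add: "Modules.additive (R \<beta>)" for \<beta>
    by unfold_locales (simp add: R_def c_add algebra_simps sum.distrib)
  have R_id: "R (\<lambda>b. b) x = x" if "x \<in> V" for x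
    using c_sum[OF that] by (simp add: R_def)
  \<comment> \<open>Since \<open>V\<close> is finite, a small change of the basis elements keeps its
    positive elements positive.\<close>
  obtain e where e: "e > 0"
    and pos: "\<And>\<beta> x. (\<And>b. b \<in> B \<Longrightarrow> \<bar>\<beta> b - b\<bar> < e) \<Longrightarrow> x \<in> V \<Longrightarrow> 0 < x \<Longrightarrow> 0 < R \<beta> x"
  proof -
    \<comment> \<open>\<open>\<delta>\<close> is a lower bound for the positive elements of
      \<open>V\<close>, where the inserted \<open>1\<close> covers the case that there are none.
      \<open>M\<close> strictly exceeds every coordinate sum, so a change by less than
      \<open>\<delta> / M\<close> moves each value by less than \<open>\<delta>\<close>.\<close>
    define \<delta> where "\<delta> = Min (insert 1 {x\<in>V. 0 < x})"
    define M where "M = 1 + (\<Sum>x\<in>V. \<Sum>b\<in>B. \<bar>c x b\<bar>)"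
    have \<delta>: "\<delta> > 0" "\<And>x. x \<in> V \<Longrightarrow> 0 < x \<Longrightarrow> \<delta> \<le> x"
      using fin by (auto simp: \<delta>_def)
    have M: "M > 0" "\<And>x. x \<in> V \<Longrightarrow> (\<Sum>b\<in>B. \<bar>c x b\<bar>) < M"
    proof -
      have "0 \<le> (\<Sum>x\<in>V. \<Sum>b\<in>B. \<bar>c x b\<bar>)"
        by (intro sum_nonneg) auto
      then show "M > 0"
        by (simp add: M_def)
      fix x assume "x \<in> V"
      then have "(\<Sum>b\<in>B. \<bar>c x b\<bar>) \<le> (\<Sum>x\<in>V. \<Sum>b\<in>B. \<bar>c x b\<bar>)"
        by (intro member_le_sum fin sum_nonneg) auto
      then show "(\<Sum>b\<in>B. \<bar>c x b\<bar>) < M"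
        by (simp add: M_def)
    qed
    show ?thesis
    proof (rule that[of "\<delta> / M"])
      show "\<delta> / M > 0"
        using \<delta> M by simp
      fix \<beta> x
      assume near: "\<And>b. b \<in> B \<Longrightarrow> \<bar>\<beta> b - b\<bar> < \<delta> / M" and x: "x \<in> V" "0 < x"
      have "\<bar>R \<beta> x - x\<bar> = \<bar>\<Sum>b\<in>B. (\<beta> b - b) * c x b\<bar>"
        using R_id[OF x(1)] by (simp add: R_def sum_subtractf algebra_simps)
      also have "\<dots> \<le> (\<Sum>b\<in>B. \<bar>\<beta> b - b\<bar> * \<bar>c x b\<bar>)"
        using sum_abs[of "\<lambda>b. (\<beta> b - b) * c x b" B] by (simp add: abs_mult)
      also have "\<dots> \<le> (\<Sum>b\<in>B. \<delta> / M * \<bar>c x b\<bar>)"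
        using near by (intro sum_mono mult_right_mono) (auto intro: less_imp_le)
      also have "\<dots> = \<delta> / M * (\<Sum>b\<in>B. \<bar>c x b\<bar>)"
        by (simp add: sum_distrib_left)
      also have "\<dots> < \<delta> / M * M"
        using M \<delta> x by (intro mult_strict_left_mono) auto
      also have "\<dots> \<le> x"
        using M \<delta> x by simp
      finally show "0 < R \<beta> x"
        by linarith
    qed
  qed
  have rational: "D (R \<beta>)" if near: "\<And>b. b \<in> B \<Longrightarrow> \<bar>\<beta> b - b\<bar> < e" and rat: "\<And>b. b \<in> B \<Longrightarrow> \<beta> b \<in> \<rat>" for \<beta>
  proof -
    have "R \<beta> x \<in> \<rat>" for x
      unfolding R_def c_def using rat by (intro Rats_sum Rats_mult) auto
    then obtain N :: nat where N: "N > 0" "\<And>x. x \<in> V \<Longrightarrow> real N * R \<beta> x \<in> \<int>"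
      using finite_common_denominator[OF fin, of "R \<beta>"] by auto
    have nn: "0 \<le> R \<beta> x" if "x \<in> V" for x
      using nonneg[OF that] pos[OF near that] Modules.additive.zero[OF R_add, of \<beta>]
      by (cases "x = 0") auto
    have "D (\<lambda>x. real N * R \<beta> x)"
    proof (rule base)
      show "Modules.additive (\<lambda>x. real N * R \<beta> x)"
        by unfold_locales (simp add: Modules.additive.add[OF R_add] algebra_simps)
      show "(\<lambda>x. real N * R \<beta> x) ` V \<subseteq> \<nat>"
        using N nn by (auto simp: Nats_altdef2)
      show "0 < real N * R \<beta> x" if "x \<in> V" "0 < x" for x
        using N pos[OF near that] by simp
    qed
    \<comment> \<open>\<open>comb\<close> joins two maps, so division by \<open>N\<close> is done by
      adding two copies of the same map with weight \<open>1 / (2 * real N)\<close>.\<close>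
    from comb[OF this this, of "1 / (2 * real N)" "1 / (2 * real N)"] N
    have "D (\<lambda>x. R \<beta> x / 2 + R \<beta> x / 2)"
      by (simp add: field_simps)
    then show ?thesis
      by simp
  qed
  text \<open>Every coordinate in \<open>S\<close> is a convex combination of two rational ones.\<close>
  have "D (R \<beta>)" if "finite S" "S \<subseteq> B" "\<And>b. b \<in> B \<Longrightarrow> \<bar>\<beta> b - b\<bar> < e" "\<And>b. b \<in> B - S \<Longrightarrow> \<beta> b \<in> \<rat>" for S \<beta>
    using that
  proof (induction S arbitrary: \<beta> rule: finite_induct)
    case empty
    then show ?case using rational by auto
  next
    case (insert k S)
    have near: "\<bar>\<beta> k - k\<bar> < e"
      using insert.prems by auto
    obtain u where u: "u \<in> \<rat>" "k - e < u" "u < \<beta> k"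
      using Rats_dense_in_real[of "k - e" "\<beta> k"] near by (auto simp: abs_less_iff)
    obtain v where v: "v \<in> \<rat>" "v < k + e" "\<beta> k < v"
      using Rats_dense_in_real[of "\<beta> k" "k + e"] near by (auto simp: abs_less_iff)
    have D: "D (R (\<beta>(k := u)))" "D (R (\<beta>(k := v)))"
      using insert.prems u v near by (auto intro!: insert.IH)
    define t where "t = (\<beta> k - u) / (v - u)"
    have "t * (v - u) = \<beta> k - u" and t: "0 < t" "0 < 1 - t"
      using u v by (auto simp: t_def)
    then have tuv: "(1 - t) * u + t * v = \<beta> k"
      by (simp add: algebra_simps)
    have "R \<beta> x = (1 - t) * R (\<beta>(k := u)) x + t * R (\<beta>(k := v)) x" for x
    proof -
      have "(1 - t) * ((\<beta>(k := u)) b * c x b) + t * ((\<beta>(k := v)) b * c x b) = \<beta> b * c x b" for b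
      proof (cases "b = k")
        case True
        then show ?thesis
          using arg_cong[OF tuv, of "\<lambda>z. z * c x b"] by (simp add: algebra_simps)
      qed (simp add: algebra_simps)
      then show ?thesis
        by (simp add: R_def sum_distrib_left flip: sum.distrib)
    qed
    then have "R \<beta> = (\<lambda>x. (1 - t) * R (\<beta>(k := u)) x + t * R (\<beta>(k := v)) x)"
      by blast
    then show ?case
      using comb[OF D t(2,1)] by simp
  qed
  from this[OF finB order_refl, of "\<lambda>b. b"] e have "D (R (\<lambda>b. b))"
    by simp
  then show ?thesis
    using R_id by blast
qed

section \<open>The sum of a polytope and the nonnegative orthant\<close>

text \<open>A vector is the sum of its axis components, so they can be added one at a time. This
  serves both for faces of a sum with the orthant and for Newton polyhedra.\<close>

lemma add_vector_mem:
  fixes x w :: "real ^ 'n"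
  assumes step: "\<And>x i. x \<in> S \<Longrightarrow> x + axis i (w $ i) \<in> S" and x: "x \<in> S"
  shows "x + w \<in> S"
proof -
  have "x + (\<Sum>i\<in>T. axis i (w $ i)) \<in> S" if "finite T" for T
    using that
  proof (induction T rule: finite_induct)
    case (insert i T)
    then show ?case
      using step[of "x + (\<Sum>i\<in>T. axis i (w $ i))" i] by (simp add: algebra_simps)
  qed (simp add: x)
  moreover have "(\<Sum>i\<in>UNIV. axis i (w $ i)) = w"
    by (simp add: vec_eq_iff axis_def if_distrib[of "\<lambda>z. z = _"] cong: if_cong)
  ultimately show ?thesis
    using finite[of UNIV] by metis
qed

text \<open>A closed convex set with finitely many faces is a polyhedron. Every face of the sum is a
  face of \<open>P\<close> plus the face of the orthant spanned by a set \<open>D\<close> of axes,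
  and there are finitely many such pairs.\<close>

lemma polyhedron_polytope_plus_orthant:
  fixes P :: "(real ^ 'n) set"
  assumes "polytope P"
  shows "polyhedron {v + w |v w. v \<in> P \<and> (\<forall>i. 0 \<le> w $ i)}" (is "polyhedron ?S")
proof -
  let ?O = "{w :: real ^ 'n. \<forall>i. 0 \<le> w $ i}"
  have S: "?S = (\<Union>v\<in>P. \<Union>w\<in>?O. {v + w})"
    by blast
  have Oeq: "?O = (\<Inter>i. {w. 0 \<le> w $ i})"
    by auto
  have "closed ?S"
    unfolding S Oeq using assms
    by (intro compact_closed_sums polytope_imp_compact closed_INT) (auto intro: closed_halfspace_component_ge_cart)
  moreover have "convex ?O"
    by (auto simp: convex_def)
  then have "convex ?S"
    unfolding S by (rule convex_sums[OF polytope_imp_convex[OF assms]])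
  moreover have "finite {F. F face_of ?S}"
  proof (rule finite_surj)
    show "finite ({G. G face_of P} \<times> (UNIV :: 'n set set))"
      using assms by (simp add: finite_polytope_faces)
    let ?h = "\<lambda>(G, D). {v + w |v (w :: real ^ 'n). v \<in> G \<and> (\<forall>i. 0 \<le> w $ i) \<and> (\<forall>i. i \<notin> D \<longrightarrow> w $ i = 0)}"
    show "{F. F face_of ?S} \<subseteq> ?h ` ({G. G face_of P} \<times> UNIV)"
    proof
      fix F assume "F \<in> {F. F face_of ?S}"
      then have F: "F face_of ?S" by simp
      have FS: "F \<subseteq> ?S"
        using F by (rule face_of_imp_subset)
      \<comment> \<open>The face property for midpoints, including the degenerate case
        \<open>p = q\<close> that open segments exclude.\<close>
      have Fmid: "p \<in> F \<and> q \<in> F" if "p \<in> ?S" "q \<in> ?S" "(1/2) *\<^sub>R p + (1/2) *\<^sub>R q \<in> F" for p q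
      proof (cases "p = q")
        case True
        then show ?thesis using that(3) by (simp flip: scaleR_left.add)
      next
        case False
        then have "(1/2) *\<^sub>R p + (1/2) *\<^sub>R q \<in> open_segment p q"
          by (auto simp: in_segment intro!: exI[of _ "1/2"])
        then show ?thesis
          using F that unfolding face_of_def by blast
      qed
      have S_add: "x + w \<in> ?S" if x: "x \<in> ?S" and w: "\<And>i. 0 \<le> w $ i" for x w :: "real ^ 'n"
      proof -
        from x obtain v and u :: "real ^ 'n" where "x = v + u" "v \<in> P" "\<forall>i. 0 \<le> u $ i"
          by blast
        then have "x + w = v + (u + w)" "v \<in> P" "\<forall>i. 0 \<le> (u + w) $ i"
          using w by (auto simp: add.assoc)
        then show ?thesis by blast
      qed
      have PS: "P \<subseteq> ?S"
      proof
        fix v assume "v \<in> P"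
        then have "v = v + 0 \<and> v \<in> P \<and> (\<forall>i. 0 \<le> (0 :: real ^ 'n) $ i)" by simp
        then show "v \<in> ?S" by blast
      qed
      have z: "axis i 0 = (0 :: real ^ 'n)" for i by (simp add: vec_eq_iff axis_def)
      \<comment> \<open>\<open>D\<close> collects the axes along which \<open>F\<close> is
        unbounded: the axis directions in its recession cone.\<close>
      define D where "D = {i. \<forall>f\<in>F. \<forall>c\<ge>0. f + axis i c \<in> F}"
      have split: "v \<in> F \<and> (\<forall>i. i \<notin> D \<longrightarrow> w $ i = 0)"
        if v: "v \<in> P" and w: "\<forall>i. 0 \<le> w $ i" and x: "v + w \<in> F" for v w :: "real ^ 'n"
      proof
        \<comment> \<open>The point \<open>v + w\<close> of the face is the midpoint of
          \<open>v\<close> and \<open>v + 2 w\<close>, which forces \<open>v\<close> into the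
          face.\<close>
        have "(1/2) *\<^sub>R v + (1/2) *\<^sub>R (v + 2 *\<^sub>R w) = v + w"
          by (simp add: vec_eq_iff field_simps)
        moreover have "v \<in> ?S"
          using v PS by blast
        moreover from this have "v + 2 *\<^sub>R w \<in> ?S"
          using w by (intro S_add) auto
        ultimately have "v \<in> F \<and> v + 2 *\<^sub>R w \<in> F"
          using x by (intro Fmid) auto
        then show "v \<in> F" by simp
        show "\<forall>i. i \<notin> D \<longrightarrow> w $ i = 0"
        proof (intro allI impI, rule ccontr)
          fix i assume i: "i \<notin> D" "w $ i \<noteq> 0"
          then have wi: "w $ i > 0"
            using w by (simp add: less_le)
          define x where "x = v + w"
          have low: "v + (w - axis i (w $ i)) \<in> ?S"
            using v w PS by (intro S_add) (auto simp: axis_def)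
          have xF: "x + axis i c \<in> F" if "c \<ge> 0" for c
          proof (cases "c = 0")
            case True
            then show ?thesis using \<open>v + w \<in> F\<close> by (simp add: x_def z)
          next
            case False
            have up: "x + axis i c \<in> ?S"
              using FS \<open>v + w \<in> F\<close> that by (intro S_add) (auto simp: axis_def x_def)
            \<comment> \<open>As \<open>w $ i\<close> is positive, \<open>x\<close> can be moved
              back by \<open>w $ i\<close> along axis \<open>i\<close> within the sum, so it is an
              inner point of a segment ending at \<open>x + axis i c\<close>. The weight
              \<open>t\<close> solves \<open>t * c = (1 - t) * w $ i\<close>.\<close>
            have "x \<in> open_segment (v + (w - axis i (w $ i))) (x + axis i c)"
            proof -
              define t where "t = w $ i / (w $ i + c)"
              have t: "0 < t" "t < 1" and tc: "t * c = (1 - t) * w $ i"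
                using wi that False by (auto simp: t_def field_simps)
              have "x = (1 - t) *\<^sub>R (v + (w - axis i (w $ i))) + t *\<^sub>R (x + axis i c)"
                using tc by (auto simp: vec_eq_iff x_def axis_def algebra_simps)
              moreover have "v + (w - axis i (w $ i)) \<noteq> x + axis i c"
                using wi that by (auto simp: vec_eq_iff x_def axis_def intro!: exI[of _ i])
              ultimately show ?thesis
                using t by (auto simp: in_segment)
            qed
            then show ?thesis
              using F low up \<open>v + w \<in> F\<close> unfolding face_of_def x_def by blast
          qed
          have "f + axis i c \<in> F" if f: "f \<in> F" and c: "c \<ge> 0" for f c
          proof -
            \<comment> \<open>The midpoint of \<open>f\<close> and \<open>x + axis i c\<close> is
              also the midpoint of \<open>f + axis i c\<close> and \<open>x\<close>. This carries
              the ray from \<open>x\<close> over to every point of the face, so that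
              \<open>i\<close> would belong to \<open>D\<close>.\<close>
            have "(1/2) *\<^sub>R f + (1/2) *\<^sub>R (x + axis i c) \<in> F"
              using face_of_imp_convex[OF F] f xF[OF c] by (auto intro: convexD)
            then have "(1/2) *\<^sub>R (f + axis i c) + (1/2) *\<^sub>R x \<in> F"
              by (simp add: algebra_simps)
            moreover have "f + axis i c \<in> ?S"
              using f FS c by (intro S_add) (auto simp: axis_def)
            moreover have "x \<in> ?S"
              using FS \<open>v + w \<in> F\<close> by (auto simp: x_def)
            ultimately show ?thesis
              using Fmid by blast
          qed
          then show False
            using i by (auto simp: D_def)
        qed
      qed
      have D_add: "f + w \<in> F" if "f \<in> F" "\<forall>i. 0 \<le> w $ i" "\<forall>i. i \<notin> D \<longrightarrow> w $ i = 0" for f w :: "real ^ 'n"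
      proof (rule add_vector_mem[OF _ \<open>f \<in> F\<close>])
        show "x + axis i (w $ i) \<in> F" if "x \<in> F" for x i
          using that \<open>\<forall>i. 0 \<le> w $ i\<close> \<open>\<forall>i. i \<notin> D \<longrightarrow> w $ i = 0\<close>
          by (cases "i \<in> D") (auto simp: D_def z)
      qed
      have "F \<inter> P face_of P"
        using face_of_slice[OF F polytope_imp_convex[OF assms]] PS by (simp add: Int_absorb1 inf.absorb2)
      moreover have "F = ?h (F \<inter> P, D)"
      proof
        show "F \<subseteq> ?h (F \<inter> P, D)"
        proof
          fix x assume x: "x \<in> F"
          then obtain v and w :: "real ^ 'n" where vw: "x = v + w" "v \<in> P" "\<forall>i. 0 \<le> w $ i"
            using FS by blast
          with split[of v w] x show "x \<in> ?h (F \<inter> P, D)"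
            by auto
        qed
        show "?h (F \<inter> P, D) \<subseteq> F"
          using D_add by auto
      qed
      ultimately show "F \<in> ?h ` ({G. G face_of P} \<times> UNIV)"
        by blast
    qed
  qed
  ultimately show ?thesis
    by (simp add: polyhedron_eq_finite_faces)
qed

section \<open>Dickson's lemma\<close>

text \<open>Every sequence has a monotone subsequence. If it is decreasing, it is constant from the
  point where its least value is attained, and that tail is increasing.\<close>

lemma increasing_subsequence_nat:
  fixes s :: "nat \<Rightarrow> nat"
  shows "\<exists>h. strict_mono h \<and> incseq (\<lambda>n. s (h n))"
proof -
  obtain h where h: "strict_mono h" "monoseq (\<lambda>n. s (h n))"
    using seq_monosub by blast
  show ?thesis
  proof (cases "incseq (\<lambda>n. s (h n))")
    case True
    then show ?thesis using h by blast
  next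
    case False
    then have dec: "decseq (\<lambda>n. s (h n))"
      using h(2) by (simp add: monoseq_iff)
    obtain m where m: "\<And>n. s (h m) \<le> s (h n)"
      using ex_has_least_nat[of "\<lambda>_. True" 0 "\<lambda>n. s (h n)"] by auto
    have "s (h (n + m)) = s (h m)" for n
      using decseqD[OF dec, of m "n + m"] m by (intro antisym) auto
    moreover have "strict_mono (\<lambda>n. h (n + m))"
      using h(1) by (simp add: strict_mono_def)
    ultimately show ?thesis
      by (intro exI[of _ "\<lambda>n. h (n + m)"]) (simp add: incseq_def)
  qed
qed

text \<open>Passing to subsequences one coordinate at a time makes all of the finitely many
  coordinates increasing at once.\<close>

lemma dickson_sequence:
  fixes f :: "nat \<Rightarrow> 'n::finite \<Rightarrow> nat"
  shows "\<exists>i j. i < j \<and> (\<forall>k. f i k \<le> f j k)"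
proof -
  have "\<exists>g. strict_mono g \<and> (\<forall>k\<in>T. incseq (\<lambda>n. f (g n) k))" if "finite T" for T
    using that
  proof (induction T rule: finite_induct)
    case empty
    then show ?case using strict_mono_id by auto
  next
    case (insert k T)
    then obtain g where g: "strict_mono g" "\<forall>k\<in>T. incseq (\<lambda>n. f (g n) k)"
      by blast
    obtain h where h: "strict_mono h" "incseq (\<lambda>n. f (g (h n)) k)"
      using increasing_subsequence_nat[of "\<lambda>n. f (g n) k"] by blast
    have "incseq (\<lambda>n. f (g (h n)) l)" if "l \<in> T" for l
      using g(2) that strict_mono_leD[OF h(1)] by (auto simp: incseq_def)
    then have "\<forall>l\<in>insert k T. incseq (\<lambda>n. f ((g \<circ> h) n) l)"
      using h(2) by auto
    then show ?case
      using strict_mono_o[OF g(1) h(1)] by blast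
  qed
  from this[of UNIV] obtain g where g: "strict_mono g" "\<And>k. incseq (\<lambda>n. f (g n) k)"
    by auto
  have "g 0 < g 1" "\<forall>k. f (g 0) k \<le> f (g 1) k"
    using g by (auto simp: strict_mono_def incseq_def)
  then show ?thesis by blast
qed

text \<open>\<open>A0\<close> consists of the elements of \<open>A\<close> that are minimal for
  divisibility. Infinitely many of them would contain two comparable ones, against
  minimality.\<close>

lemma dickson_finite_divisors:
  fixes A :: "('n::finite \<Rightarrow>\<^sub>0 nat) set"
  shows "\<exists>A0. finite A0 \<and> A0 \<subseteq> A \<and> (\<forall>a\<in>A. \<exists>g\<in>A0. \<exists>c. a = g + c)"
proof -
  define le where "le g a \<longleftrightarrow> (\<forall>k. Poly_Mapping.lookup g k \<le> Poly_Mapping.lookup a k)" for g a :: "'n \<Rightarrow>\<^sub>0 nat"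
  define A0 where "A0 = {a\<in>A. \<forall>g\<in>A. le g a \<longrightarrow> g = a}"
  have "finite A0"
  proof (rule ccontr)
    assume "infinite A0"
    then obtain f :: "nat \<Rightarrow> 'n \<Rightarrow>\<^sub>0 nat" where f: "inj f" "range f \<subseteq> A0"
      using infinite_countable_subset by blast
    obtain i j where "i < j" "le (f i) (f j)"
      using dickson_sequence[of "\<lambda>i. Poly_Mapping.lookup (f i)"] by (auto simp: le_def)
    moreover have "f i \<in> A0" "f j \<in> A0"
      using f(2) by auto
    ultimately have "f i = f j"
      by (simp add: A0_def)
    then show False
      using f(1) \<open>i < j\<close> by (simp add: inj_eq)
  qed
  moreover have "\<exists>g\<in>A0. \<exists>c. a = g + c" if "a \<in> A" for a
  proof -
    \<comment> \<open>A divisor of \<open>a\<close> in \<open>A\<close> of least total degree is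
      minimal, because a proper divisor has smaller degree.\<close>
    define deg where "deg g = (\<Sum>k\<in>UNIV. Poly_Mapping.lookup g k)" for g :: "'n \<Rightarrow>\<^sub>0 nat"
    have "a \<in> A \<and> le a a"
      using that by (simp add: le_def)
    then obtain g where g: "g \<in> A" "le g a" and min: "\<And>h. h \<in> A \<Longrightarrow> le h a \<Longrightarrow> deg g \<le> deg h"
      using ex_has_least_nat[of "\<lambda>g. g \<in> A \<and> le g a" a deg] by auto
    have "h = g" if h: "h \<in> A" "le h g" for h
    proof -
      have "le h a"
        using h(2) g(2) by (meson le_def le_trans)
      then have eq: "deg g = deg h"
        using min[OF h(1)] sum_mono[of UNIV "Poly_Mapping.lookup h" "Poly_Mapping.lookup g"] h(2)
        by (auto simp: deg_def le_def intro: antisym)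
      have "Poly_Mapping.lookup h k = Poly_Mapping.lookup g k" for k
      proof (rule ccontr)
        assume "Poly_Mapping.lookup h k \<noteq> Poly_Mapping.lookup g k"
        then have "deg h < deg g"
          unfolding deg_def using h(2) by (intro sum_strict_mono_ex1) (auto simp: le_def le_less)
        then show False
          using eq by simp
      qed
      then show ?thesis
        by (rule poly_mapping_eqI)
    qed
    then have "g \<in> A0"
      using g(1) by (auto simp: A0_def)
    moreover have "a = g + (a - g)"
      using g(2) by (intro poly_mapping_eqI) (simp add: lookup_add lookup_minus le_def)
    ultimately show ?thesis
      by blast
  qed
  moreover have "A0 \<subseteq> A"
    by (auto simp: A0_def)
  ultimately show ?thesis
    by blast
qed

section \<open>Monomial ideals and Newton polyhedra\<close>

lemma mpoly_ring_simps [simp]: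
  "carrier mpoly_ring = UNIV" "p \<otimes>\<^bsub>mpoly_ring\<^esub> q = p * q" "p \<oplus>\<^bsub>mpoly_ring\<^esub> q = p + q"
  "\<zero>\<^bsub>mpoly_ring\<^esub> = 0" "\<one>\<^bsub>mpoly_ring\<^esub> = 1"
  by (simp_all add: mpoly_ring_def ring_of_type_algebra_def)

interpretation mpoly: cring "mpoly_ring :: ('n::finite, 'k::field) mpoly ring"
  unfolding mpoly_ring_def by (rule cring_from_type_algebra)

lemma monomial_add: "monomial (a + b) = monomial a * monomial b"
  by (simp add: monomial_def mult_single)

lemma keys_monomial [simp]: "Poly_Mapping.keys (monomial a :: ('n::finite, 'k::field) mpoly) = {a}"
  by (simp add: monomial_def)

text \<open>Supports of products lie in sums of supports. Such ideals serve as upper bounds for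
  generated ideals: it then suffices to inspect the generators.\<close>

lemma ideal_keys_subset:
  fixes U :: "('n::finite \<Rightarrow>\<^sub>0 nat) set"
  assumes up: "\<And>a c. a \<in> U \<Longrightarrow> a + c \<in> U"
  shows "ideal {p :: ('n, 'k::field) mpoly. Poly_Mapping.keys p \<subseteq> U} mpoly_ring" (is "ideal ?M _")
proof (rule idealI)
  show "ring (mpoly_ring :: ('n, 'k) mpoly ring)"
    by (rule mpoly.ring_axioms)
  have mult: "p * q \<in> ?M" if "p \<in> ?M" for p q
    using keys_mult[of p q] that up by fastforce
  then show "x \<otimes>\<^bsub>mpoly_ring\<^esub> p \<in> ?M" "p \<otimes>\<^bsub>mpoly_ring\<^esub> x \<in> ?M" if "p \<in> ?M" for p x
    using that by (simp_all add: mult.commute[of x])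
  show "subgroup ?M (add_monoid mpoly_ring)"
  proof (rule mpoly.add.subgroupI)
    show "?M \<noteq> {}"
      by (auto intro: exI[of _ 0])
    fix p assume p: "p \<in> ?M"
    \<comment> \<open>Negation in the ring record is rewritten as a product, so that closure under
      multiplication covers it.\<close>
    have "\<ominus>\<^bsub>mpoly_ring\<^esub> p = p * (- 1)"
      by (rule mpoly.minus_equality) auto
    then show "\<ominus>\<^bsub>mpoly_ring\<^esub> p \<in> ?M"
      using mult[OF p, of "- 1"] by simp
    fix q assume "q \<in> ?M"
    then show "p \<oplus>\<^bsub>mpoly_ring\<^esub> q \<in> ?M"
      using p keys_add[of p q] by auto
  qed simp
qed

lemma genideal_monomials_keys:
  fixes p :: "('n::finite, 'k::field) mpoly"
  assumes "p \<in> genideal mpoly_ring (monomial ` A)" "a \<in> Poly_Mapping.keys p"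
  shows "\<exists>g\<in>A. \<exists>c. a = g + c"
proof -
  let ?U = "{a. \<exists>g\<in>A. \<exists>c. a = g + c}"
  have "ideal {p :: ('n, 'k) mpoly. Poly_Mapping.keys p \<subseteq> ?U} mpoly_ring"
  proof (rule ideal_keys_subset)
    fix a c assume "a \<in> ?U"
    then obtain g d where "g \<in> A" "a + c = g + (d + c)"
      by (auto simp: add.assoc)
    then show "a + c \<in> ?U"
      by blast
  qed
  moreover have "monomial ` A \<subseteq> {p :: ('n, 'k) mpoly. Poly_Mapping.keys p \<subseteq> ?U}"
    by auto (metis add.right_neutral)
  ultimately have "genideal mpoly_ring (monomial ` A) \<subseteq> {p :: ('n, 'k) mpoly. Poly_Mapping.keys p \<subseteq> ?U}"
    by (rule mpoly.genideal_minimal)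
  then show ?thesis
    using assms by blast
qed

lemma ideal_monomial_add:
  assumes "ideal J mpoly_ring" "monomial a \<in> J"
  shows "monomial (a + c) \<in> J"
  using ideal.I_r_closed[OF assms, of "monomial c"] by (simp add: monomial_add)

lemma monomial_ideal_imp_ideal: "monomial_ideal J \<Longrightarrow> ideal J mpoly_ring"
  by (auto simp: monomial_ideal_def intro: mpoly.genideal_ideal)

lemma monomial_ideal_keys:
  assumes J: "monomial_ideal J" and p: "p \<in> J" "a \<in> Poly_Mapping.keys p"
  shows "monomial a \<in> J"
proof -
  obtain A where A: "J = genideal mpoly_ring (monomial ` A)"
    using J by (auto simp: monomial_ideal_def)
  then obtain g c where g: "g \<in> A" "a = g + c"
    using genideal_monomials_keys p by blast
  then have "monomial g \<in> J"
    using mpoly.genideal_self[of "monomial ` A"] A by auto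
  then show ?thesis
    using ideal_monomial_add[OF monomial_ideal_imp_ideal[OF J]] g by blast
qed

section \<open>Exponent vectors and Newton polyhedra\<close>

lemma exponent_vector_add: "exponent_vector (a + b) = exponent_vector a + exponent_vector b"
  by (simp add: exponent_vector_def vec_eq_iff lookup_add)

lemma exponent_vector_0 [simp]: "exponent_vector 0 = 0"
  by (simp add: exponent_vector_def vec_eq_iff)

lemma exponent_vector_nonneg [simp]: "0 \<le> exponent_vector a $ i"
  by (simp add: exponent_vector_def)

lemma exponent_vector_inject: "exponent_vector a = exponent_vector b \<longleftrightarrow> a = b"
  by (auto simp: exponent_vector_def vec_eq_iff intro: poly_mapping_eqI)

text \<open>Multiplication by powers of a variable makes the hull stable under integral shifts along
  an axis. A real shift of \<open>x\<close> is reached by convexity, between \<open>x\<close> and a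
  longer integral shift.\<close>

lemma newton_polyhedron_add_nonneg:
  fixes J :: "('n::finite, 'k::field) mpoly set" and w :: "real ^ 'n"
  assumes J: "ideal J mpoly_ring" and v: "v \<in> newton_polyhedron J" and w: "\<And>i. 0 \<le> w $ i"
  shows "v + w \<in> newton_polyhedron J"
proof (rule add_vector_mem[OF _ v])
  let ?E = "exponent_vector ` {a. monomial a \<in> J}"
  fix x and i :: 'n
  assume x: "x \<in> newton_polyhedron J"
  obtain N :: nat where N: "w $ i < real N"
    using reals_Archimedean2 by blast
  let ?z = "axis i (real N) :: real ^ 'n"
  have "(+) ?z ` ?E \<subseteq> ?E"
  proof clarify
    fix a assume "monomial a \<in> J"
    then have "monomial (a + Poly_Mapping.single i N) \<in> J"
      by (rule ideal_monomial_add[OF J])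
    moreover have "?z + exponent_vector a = exponent_vector (a + Poly_Mapping.single i N)"
      by (auto simp: vec_eq_iff exponent_vector_def lookup_add lookup_single axis_def)
    ultimately show "?z + exponent_vector a \<in> ?E"
      by simp
  qed
  then have "(+) ?z ` newton_polyhedron J \<subseteq> newton_polyhedron J"
    unfolding newton_polyhedron_def convex_hull_translation[symmetric] by (rule hull_mono)
  then have "x + ?z \<in> newton_polyhedron J"
    using x by (auto simp: add.commute[of x])
  moreover have "(w $ i / N) *\<^sub>R ?z = axis i (w $ i)"
    using N w[of i] by (simp add: vec_eq_iff axis_def)
  then have "(1 - w $ i / N) *\<^sub>R x + (w $ i / N) *\<^sub>R (x + ?z) = x + axis i (w $ i)"
    by (simp add: scaleR_add_right flip: scaleR_left.add add.assoc)
  moreover have "convex (newton_polyhedron J)"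
    by (simp add: newton_polyhedron_def)
  ultimately show "x + axis i (w $ i) \<in> newton_polyhedron J"
    using x N w[of i] convexD_alt[of "newton_polyhedron J" x "x + ?z" "w $ i / N"]
    by simp
qed

text \<open>The polytope is the hull of the finitely many exponents that Dickson's lemma extracts
  from the generators; every other exponent of \<open>J\<close> exceeds one of them by a nonnegative
  vector.\<close>

lemma polyhedron_newton_polyhedron:
  fixes J :: "('n::finite, 'k::field) mpoly set"
  assumes "monomial_ideal J"
  shows "polyhedron (newton_polyhedron J)"
proof -
  obtain A where A: "J = genideal mpoly_ring (monomial ` A)"
    using assms by (auto simp: monomial_ideal_def)
  obtain A0 where A0: "finite A0" "A0 \<subseteq> A" "\<And>a. a \<in> A \<Longrightarrow> \<exists>g\<in>A0. \<exists>c. a = g + c"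
    using dickson_finite_divisors[of A] by metis
  let ?S = "{v + w |v w. v \<in> convex hull (exponent_vector ` A0) \<and> (\<forall>i. 0 \<le> w $ i)}"
  have poly: "polyhedron ?S"
    using A0(1) by (intro polyhedron_polytope_plus_orthant polytope_convex_hull) auto
  have "newton_polyhedron J = ?S"
  proof
    show "newton_polyhedron J \<subseteq> ?S"
      unfolding newton_polyhedron_def
    proof (rule hull_minimal)
      show "exponent_vector ` {a. monomial a \<in> J} \<subseteq> ?S"
      proof clarify
        fix a assume "monomial a \<in> J"
        then obtain g c where g: "g \<in> A" "a = g + c"
          using genideal_monomials_keys[of "monomial a" A a] A by auto
        obtain g0 d where "g0 \<in> A0" "g = g0 + d"
          using A0(3)[OF g(1)] by blast
        then have "exponent_vector a = exponent_vector g0 + exponent_vector (d + c)"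
            "exponent_vector g0 \<in> convex hull (exponent_vector ` A0)"
          using g by (auto simp: exponent_vector_add intro: hull_inc)
        then show "\<exists>v w. exponent_vector a = v + w \<and> v \<in> convex hull (exponent_vector ` A0) \<and> (\<forall>i. 0 \<le> w $ i)"
          using exponent_vector_nonneg by blast
      qed
      show "convex ?S"
        using poly by (rule polyhedron_imp_convex)
    qed
    have "A0 \<subseteq> {a. monomial a \<in> J}"
      using A0(2) mpoly.genideal_self[of "monomial ` A"] A by auto
    then have "convex hull (exponent_vector ` A0) \<subseteq> newton_polyhedron J"
      unfolding newton_polyhedron_def by (intro hull_mono image_mono)
    then show "?S \<subseteq> newton_polyhedron J"
      using newton_polyhedron_add_nonneg[OF monomial_ideal_imp_ideal[OF assms]] by blast
  qed
  then show ?thesis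
    using poly by simp
qed

section \<open>Powers of monomial ideals\<close>

lemma comm_monoid_ideals_set: "comm_monoid (ideals_set (mpoly_ring :: ('n::finite, 'k::field) mpoly ring))"
  by (rule mpoly.ideals_set_is_comm_monoid)

lemma ideal_power_0: "ideal_power J 0 = UNIV"
  by (simp add: ideal_power_def ideals_set_def)

lemma ideal_power_Suc: "ideal_power J (Suc m) = ideal_prod mpoly_ring (ideal_power J m) J"
  by (simp add: ideal_power_def ideals_set_def)

context
  fixes J :: "('n::finite, 'k::field) mpoly set"
  assumes J: "ideal J mpoly_ring"
begin

lemma ideal_ideal_power: "ideal (ideal_power J m) mpoly_ring"
proof -
  interpret M: comm_monoid "ideals_set (mpoly_ring :: ('n, 'k) mpoly ring)"
    by (rule comm_monoid_ideals_set)
  show ?thesis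
    using M.nat_pow_closed[of J m] J by (simp add: ideal_power_def ideals_set_def)
qed

lemma ideal_power_add: "ideal_prod mpoly_ring (ideal_power J l) (ideal_power J m) = ideal_power J (l + m)"
proof -
  interpret M: comm_monoid "ideals_set (mpoly_ring :: ('n, 'k) mpoly ring)"
    by (rule comm_monoid_ideals_set)
  show ?thesis
    using M.nat_pow_mult[of J l m] J by (simp add: ideal_power_def ideals_set_def)
qed

lemma ideal_power_1: "ideal_power J (Suc 0) = J"
proof -
  interpret M: comm_monoid "ideals_set (mpoly_ring :: ('n, 'k) mpoly ring)"
    by (rule comm_monoid_ideals_set)
  show ?thesis
    using M.nat_pow_eone[of J] J by (simp add: ideal_power_def ideals_set_def)
qed

lemma ideal_power_monomial_add:
  assumes "monomial a \<in> ideal_power J l" "monomial b \<in> ideal_power J m"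
  shows "monomial (a + b) \<in> ideal_power J (l + m)"
  using ideal_prod.prod[OF assms, of mpoly_ring] by (simp add: monomial_add ideal_power_add)

text \<open>Multiply \<open>n v\<close> copies of the monomial with exponent \<open>v\<close>, over
  all \<open>v\<close>. Zero coefficients and the empty set are covered because the zeroth power is
  the whole ring.\<close>

lemma ideal_power_combination:
  assumes "finite S" "S \<subseteq> exponent_vector ` {a. monomial a \<in> J}"
  shows "\<exists>b. monomial b \<in> ideal_power J (\<Sum>v\<in>S. n v) \<and> exponent_vector b = (\<Sum>v\<in>S. real (n v) *\<^sub>R v)"
  using assms
proof (induction S rule: finite_induct)
  case empty
  then show ?case by (auto simp: ideal_power_0 intro!: exI[of _ 0])
next
  case (insert v S)
  then obtain b where b: "monomial b \<in> ideal_power J (\<Sum>v\<in>S. n v)" "exponent_vector b = (\<Sum>v\<in>S. real (n v) *\<^sub>R v)"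
    by auto
  obtain a where a: "monomial a \<in> J" "v = exponent_vector a"
    using insert.prems by auto
  have "\<exists>c. monomial c \<in> ideal_power J k \<and> exponent_vector c = real k *\<^sub>R v" for k
  proof (induction k)
    case 0
    then show ?case by (auto simp: ideal_power_0 intro!: exI[of _ 0])
  next
    case (Suc k)
    then obtain c where "monomial c \<in> ideal_power J k" "exponent_vector c = real k *\<^sub>R v"
      by blast
    then have "monomial (c + a) \<in> ideal_power J (Suc k)" "exponent_vector (c + a) = real (Suc k) *\<^sub>R v"
      using ideal_power_monomial_add[of c k a "Suc 0"] a
      by (auto simp: ideal_power_1 exponent_vector_add algebra_simps)
    then show ?case by blast
  qed
  then obtain c where "monomial c \<in> ideal_power J (n v)" "exponent_vector c = real (n v) *\<^sub>R v"
    by blast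
  then have "monomial (c + b) \<in> ideal_power J (\<Sum>v\<in>insert v S. n v) \<and>
      exponent_vector (c + b) = (\<Sum>v\<in>insert v S. real (n v) *\<^sub>R v)"
    using ideal_power_monomial_add[of c "n v" b] b insert.hyps by (simp add: exponent_vector_add)
  then show ?case by blast
qed

end

text \<open>Speaking about all terms of arbitrary elements lets the induction pass through the sums
  in an ideal product. It starts at \<open>m = 1\<close>: the zeroth power contains every monomial,
  while zero times a point is only the origin.\<close>

lemma ideal_power_keys:
  fixes J :: "('n::finite, 'k::field) mpoly set"
  assumes J: "monomial_ideal J" and "1 \<le> m" "p \<in> ideal_power J m" "a \<in> Poly_Mapping.keys p"
  shows "\<exists>v\<in>newton_polyhedron J. exponent_vector a = real m *\<^sub>R v"
  using assms(2-)
proof (induction m arbitrary: p a rule: nat_induct_at_least)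
  case base
  then have "monomial a \<in> J"
    using monomial_ideal_keys[OF J] ideal_power_1[OF monomial_ideal_imp_ideal[OF J]] by simp
  then show ?case
    by (auto simp: newton_polyhedron_def intro: hull_inc)
next
  case (Suc m)
  have idealJ: "ideal J mpoly_ring"
    using J by (rule monomial_ideal_imp_ideal)
  let ?U = "{a. \<exists>v\<in>newton_polyhedron J. exponent_vector a = real (Suc m) *\<^sub>R v}"
  have up: "a + c \<in> ?U" if "a \<in> ?U" for a c
  proof -
    from that obtain v where v: "v \<in> newton_polyhedron J" "exponent_vector a = real (Suc m) *\<^sub>R v"
      by blast
    have "v + (1 / real (Suc m)) *\<^sub>R exponent_vector c \<in> newton_polyhedron J"
      by (rule newton_polyhedron_add_nonneg[OF idealJ v(1)]) simp
    moreover have "exponent_vector (a + c) = real (Suc m) *\<^sub>R (v + (1 / real (Suc m)) *\<^sub>R exponent_vector c)"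
      using v(2) by (simp add: exponent_vector_add scaleR_add_right del: of_nat_Suc)
    ultimately show ?thesis by blast
  qed
  have keys_prod: "Poly_Mapping.keys (f * g) \<subseteq> ?U" if f: "f \<in> ideal_power J m" and g: "g \<in> J" for f g
  proof
    fix a assume "a \<in> Poly_Mapping.keys (f * g)"
    then obtain b c where bc: "a = b + c" "b \<in> Poly_Mapping.keys f" "c \<in> Poly_Mapping.keys g"
      using keys_mult by blast
    obtain v where v: "v \<in> newton_polyhedron J" "exponent_vector b = real m *\<^sub>R v"
      using Suc.IH[OF f bc(2)] by blast
    have c: "exponent_vector c \<in> newton_polyhedron J"
      using monomial_ideal_keys[OF J g bc(3)] by (auto simp: newton_polyhedron_def intro: hull_inc)
    \<comment> \<open>The average of \<open>m\<close> copies of \<open>v\<close> and one copy of the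
      exponent of the new factor.\<close>
    let ?w = "(real m / real (Suc m)) *\<^sub>R v + (1 / real (Suc m)) *\<^sub>R exponent_vector c"
    have "?w \<in> newton_polyhedron J"
      by (rule convexD[OF _ v(1) c]) (auto simp: newton_polyhedron_def field_simps)
    moreover have "exponent_vector a = real (Suc m) *\<^sub>R ?w"
      using v(2) bc(1) by (simp add: exponent_vector_add scaleR_add_right del: of_nat_Suc)
    ultimately show "a \<in> ?U" by blast
  qed
  have "q \<in> ideal_prod mpoly_ring (ideal_power J m) J \<Longrightarrow> Poly_Mapping.keys q \<subseteq> ?U" for q
  proof (induction q rule: ideal_prod.induct)
    case (prod f g)
    then show ?case using keys_prod by simp
  next
    case (sum q r)
    then show ?case using keys_add[of q r] by auto
  qed
  then have "Poly_Mapping.keys p \<subseteq> ?U"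
    using Suc.prems(1) unfolding ideal_power_Suc by blast
  then show ?case
    using Suc.prems(2) by blast
qed

lemma ideal_prod_mono:
  assumes "A \<subseteq> A'" "B \<subseteq> B'"
  shows "ideal_prod R A B \<subseteq> ideal_prod R A' B'"
proof
  show "p \<in> ideal_prod R A' B'" if "p \<in> ideal_prod R A B" for p
    using that by induction (use assms in \<open>auto intro: ideal_prod.intros\<close>)
qed

section \<open>Limiting bodies\<close>

lemma graded_family_Inter_powers:
  assumes "T \<noteq> {}" and J: "\<And>i. i \<in> T \<Longrightarrow> ideal (J i) mpoly_ring"
    and I: "\<And>m. 1 \<le> m \<Longrightarrow> I m = (\<Inter>i\<in>T. ideal_power (J i) m)"
  shows "graded_family I"
  unfolding graded_family_def
proof (intro conjI allI impI)
  fix m :: nat assume "1 \<le> m"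
  then show "ideal (I m) mpoly_ring"
    using assms(1) ideal_ideal_power[OF J] by (auto simp: I intro!: mpoly.i_Intersect)
next
  fix l m :: nat assume lm: "1 \<le> l" "1 \<le> m"
  have "ideal_prod mpoly_ring (I l) (I m) \<subseteq> ideal_power (J i) (l + m)" if "i \<in> T" for i
    using ideal_prod_mono[of "I l" "ideal_power (J i) l" "I m" "ideal_power (J i) m" mpoly_ring]
      ideal_power_add[OF J[OF that]] I[OF lm(1)] I[OF lm(2)] that by auto
  then show "ideal_prod mpoly_ring (I l) (I m) \<subseteq> I (l + m)"
    using lm by (auto simp: I)
qed

lemma graded_family_monomial_add:
  assumes "graded_family I" "1 \<le> l" "1 \<le> m" "monomial a \<in> I l" "monomial b \<in> I m"
  shows "monomial (a + b) \<in> I (l + m)"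
  using assms(1-3) ideal_prod.prod[OF assms(4,5), of mpoly_ring]
  by (auto simp: graded_family_def monomial_add)

lemma graded_family_monomial_multiple:
  assumes I: "graded_family I" "1 \<le> m" "monomial a \<in> I m" and "1 \<le> k"
  shows "\<exists>b. monomial b \<in> I (k * m) \<and> exponent_vector b = real k *\<^sub>R exponent_vector a"
  using \<open>1 \<le> k\<close>
proof (induction k rule: nat_induct_at_least)
  case base
  then show ?case using I by auto
next
  case (Suc k)
  then obtain b where b: "monomial b \<in> I (k * m)" "exponent_vector b = real k *\<^sub>R exponent_vector a"
    by blast
  then have "monomial (a + b) \<in> I (Suc k * m)" "exponent_vector (a + b) = real (Suc k) *\<^sub>R exponent_vector a"
    using graded_family_monomial_add[OF I(1,2) _ I(3), of "k * m" b] I(2) Suc.hyps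
    by (auto simp: exponent_vector_add algebra_simps)
  then show ?case by blast
qed

lemma scaled_newton_polyhedron:
  "(\<lambda>y. c *\<^sub>R y) ` newton_polyhedron J = convex hull ((\<lambda>a. c *\<^sub>R exponent_vector a) ` {a. monomial a \<in> J})"
  by (simp add: newton_polyhedron_def convex_hull_scaling image_image flip: convex_hull_scaling)

text \<open>The scaled polyhedra are nested along multiples of the index, so two points of the union
  already lie in the convex piece indexed by a common multiple.\<close>

lemma convex_limiting_body:
  fixes I :: "nat \<Rightarrow> ('n::finite, 'k::field) mpoly set"
  assumes I: "graded_family I"
  shows "convex (limiting_body I)"
proof -
  define P where "P m = (\<lambda>y. (1 / real m) *\<^sub>R y) ` newton_polyhedron (I m)" for m
  have P_mult: "P m \<subseteq> P (k * m)" if mk: "1 \<le> m" "1 \<le> k" for m k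
    unfolding P_def scaled_newton_polyhedron
  proof (rule hull_mono, clarify)
    fix a assume "monomial a \<in> I m"
    then obtain b where b: "monomial b \<in> I (k * m)" "exponent_vector b = real k *\<^sub>R exponent_vector a"
      using graded_family_monomial_multiple[OF I mk(1) _ mk(2)] by blast
    then have "(1 / real m) *\<^sub>R exponent_vector a = (1 / real (k * m)) *\<^sub>R exponent_vector b"
      using mk by simp
    then show "(1 / real m) *\<^sub>R exponent_vector a \<in> (\<lambda>a. (1 / real (k * m)) *\<^sub>R exponent_vector a) ` {a. monomial a \<in> I (k * m)}"
      using b(1) by blast
  qed
  have "convex (\<Union>m\<in>{1..}. P m)"
  proof (rule convexI)
    fix x y :: "real ^ 'n" and u v :: real
    assume "x \<in> (\<Union>m\<in>{1..}. P m)" "y \<in> (\<Union>m\<in>{1..}. P m)" and uv: "0 \<le> u" "0 \<le> v" "u + v = 1"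
    then obtain l m where lm: "1 \<le> l" "1 \<le> m" and xy: "x \<in> P l" "y \<in> P m"
      by auto
    have "x \<in> P (l * m)" "y \<in> P (l * m)"
      using P_mult[OF lm] P_mult[OF lm(2,1)] xy by (auto simp: mult.commute)
    moreover have "convex (P (l * m))"
      by (simp add: P_def scaled_newton_polyhedron)
    ultimately have "u *\<^sub>R x + v *\<^sub>R y \<in> P (l * m)"
      using uv by (auto intro: convexD)
    moreover have "l * m \<in> {1..}"
      using lm by simp
    ultimately show "u *\<^sub>R x + v *\<^sub>R y \<in> (\<Union>m\<in>{1..}. P m)"
      by blast
  qed
  then show ?thesis
    by (simp add: limiting_body_def P_def)
qed

section \<open>The limiting body for intersections of powers\<close>

lemma additive_mult_of_nat:
  fixes f :: "real \<Rightarrow> real"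
  assumes "Modules.additive f"
  shows "f (x * real n) = f x * real n"
proof (induction n)
  case (Suc n)
  then show ?case
    using Modules.additive.add[OF assms, of x "x * real n"] by (simp add: algebra_simps)
qed (simp add: Modules.additive.zero[OF assms])

lemma limiting_body_Inter_powers:
  fixes J :: "'i \<Rightarrow> ('n::finite, 'k::field) mpoly set"
  assumes T: "finite T" "T \<noteq> {}" and J: "\<And>i. i \<in> T \<Longrightarrow> monomial_ideal (J i)"
    and I: "\<And>m. 1 \<le> m \<Longrightarrow> I m = (\<Inter>i\<in>T. ideal_power (J i) m)"
  shows "limiting_body I = (\<Inter>i\<in>T. newton_polyhedron (J i))"
proof
  show "limiting_body I \<subseteq> (\<Inter>i\<in>T. newton_polyhedron (J i))"
    unfolding limiting_body_def scaled_newton_polyhedron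
  proof (intro UN_least INT_greatest hull_minimal image_subsetI)
    fix m :: nat and i a assume m: "m \<in> {1..}" and i: "i \<in> T" and "a \<in> {a. monomial a \<in> I m}"
    then have a: "monomial a \<in> I m"
      by simp
    have "monomial a \<in> ideal_power (J i) m"
      using m i a by (simp add: I)
    then obtain v where "v \<in> newton_polyhedron (J i)" "exponent_vector a = real m *\<^sub>R v"
      using ideal_power_keys[OF J[OF i], of m "monomial a" a] m by auto
    then show "(1 / real m) *\<^sub>R exponent_vector a \<in> newton_polyhedron (J i)"
      using m by simp
  qed (simp add: newton_polyhedron_def)
next
  show "(\<Inter>i\<in>T. newton_polyhedron (J i)) \<subseteq> limiting_body I"
  proof
    have ideal: "ideal (J i) mpoly_ring" if "i \<in> T" for i
      using J[OF that] by (rule monomial_ideal_imp_ideal)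
    have graded: "graded_family I"
      using T(2) ideal I by (rule graded_family_Inter_powers)
    fix y assume y: "y \<in> (\<Inter>i\<in>T. newton_polyhedron (J i))"
    have "\<forall>i\<in>T. \<exists>S u. finite S \<and> S \<subseteq> exponent_vector ` {a. monomial a \<in> J i} \<and>
        (\<forall>v\<in>S. 0 \<le> u v) \<and> sum u S = 1 \<and> (\<Sum>v\<in>S. u v *\<^sub>R v) = y"
      using y by (simp add: newton_polyhedron_def convex_hull_explicit)
    from bchoice[OF this] obtain S where "\<forall>i\<in>T. \<exists>u. finite (S i) \<and> S i \<subseteq> exponent_vector ` {a. monomial a \<in> J i} \<and>
        (\<forall>v\<in>S i. 0 \<le> u v) \<and> sum u (S i) = 1 \<and> (\<Sum>v\<in>S i. u v *\<^sub>R v) = y"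
      by blast
    from bchoice[OF this] obtain u where S: "\<And>i. i \<in> T \<Longrightarrow> finite (S i)"
        "\<And>i. i \<in> T \<Longrightarrow> S i \<subseteq> exponent_vector ` {a. monomial a \<in> J i}"
      and u: "\<And>i v. i \<in> T \<Longrightarrow> v \<in> S i \<Longrightarrow> 0 \<le> u i v" "\<And>i. i \<in> T \<Longrightarrow> sum (u i) (S i) = 1"
        "\<And>i. i \<in> T \<Longrightarrow> (\<Sum>v\<in>S i. u i v *\<^sub>R v) = y"
      by blast
    have y_component: "y $ j = (\<Sum>v\<in>S i. u i v * v $ j)" if "i \<in> T" for i j
      using arg_cong[OF u(3)[OF that], of "\<lambda>z. z $ j"] by simp
    obtain i0 where i0: "i0 \<in> T"
      using T(2) by blast
    have y_nonneg: "0 \<le> y $ j" for j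
    proof -
      have "0 \<le> u i0 v * v $ j" if "v \<in> S i0" for v
        using u(1)[OF i0 that] S(2)[OF i0] that by auto
      then show ?thesis
        by (simp add: y_component[OF i0] sum_nonneg)
    qed
    \<comment> \<open>The values an additive map has to control: \<open>1\<close> becomes the
      exponent of the power, the coefficients become multiplicities, and the coordinates of
      \<open>y\<close> are included so that \<open>y\<close> is recovered at the end.\<close>
    define V where "V = insert 1 (range (($) y) \<union> (\<Union>i\<in>T. u i ` S i))"
    define Y where "Y f = (\<chi> j. f (y $ j))" for f :: "real \<Rightarrow> real"
    \<comment> \<open>\<open>D f\<close> places the pair \<open>(Y f, f 1)\<close> in the open cone
      over the limiting body, with \<open>f 1\<close> as height. Convexity of the body makes this
      stable under positive combinations.\<close>
    define D where "D f \<longleftrightarrow> 0 < f 1 \<and> (\<exists>c\<in>limiting_body I. Y f = f 1 *\<^sub>R c)" for f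
    have "\<exists>g. D g \<and> (\<forall>x\<in>V. g x = x)"
    proof (rule identity_generated_by_additive_nat_maps)
      show "finite V"
        using T(1) S(1) by (auto simp: V_def)
      show "0 \<le> x" if "x \<in> V" for x
        using that y_nonneg u(1) by (auto simp: V_def)
    next
      fix f :: "real \<Rightarrow> real"
      assume add: "Modules.additive f" and nat: "f ` V \<subseteq> \<nat>" and pos: "\<And>x. x \<in> V \<Longrightarrow> 0 < x \<Longrightarrow> 0 < f x"
      have "0 < f 1"
        using pos[of 1] by (simp add: V_def)
      moreover obtain m where m: "f 1 = real m"
        using nat by (auto simp: V_def Nats_def)
      ultimately have m1: "1 \<le> m"
        by simp
      have ex: "\<exists>b. monomial b \<in> ideal_power (J i) m \<and> exponent_vector b = Y f" if i: "i \<in> T" for i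
      proof -
        define n where "n v = nat \<lfloor>f (u i v)\<rfloor>" for v
        have n: "f (u i v) = real (n v)" if "v \<in> S i" for v
        proof -
          have "u i v \<in> V"
            using i that by (auto simp: V_def)
          then have "f (u i v) \<in> \<nat>"
            using nat by auto
          then show ?thesis
            by (auto simp: n_def Nats_def)
        qed
        \<comment> \<open>The coefficients sum to \<open>1\<close>, so their images sum to
          \<open>f 1\<close>: the number of factors is \<open>m\<close> for every
          \<open>i\<close>.\<close>
        have "real m = (\<Sum>v\<in>S i. f (u i v))"
          using Modules.additive.sum[OF add, of "u i" "S i"] u(2)[OF i] m by simp
        also have "\<dots> = real (\<Sum>v\<in>S i. n v)"
          using n by simp
        finally have m_eq: "m = (\<Sum>v\<in>S i. n v)"
          by linarith
        \<comment> \<open>Exponent vectors have natural coordinates, which additivity alone pulls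
          out of \<open>f\<close>.\<close>
        have "f (y $ j) = (\<Sum>v\<in>S i. real (n v) * v $ j)" for j
        proof -
          have "f (y $ j) = f (\<Sum>v\<in>S i. u i v * v $ j)"
            by (simp add: y_component[OF i])
          also have "\<dots> = (\<Sum>v\<in>S i. f (u i v * v $ j))"
            by (rule Modules.additive.sum[OF add])
          also have "\<dots> = (\<Sum>v\<in>S i. real (n v) * v $ j)"
          proof (rule sum.cong)
            fix v assume v: "v \<in> S i"
            then obtain k where "v $ j = real k"
              using S(2)[OF i] by (auto simp: exponent_vector_def)
            then show "f (u i v * v $ j) = real (n v) * v $ j"
              using additive_mult_of_nat[OF add] n[OF v] by simp
          qed simp
          finally show ?thesis .
        qed
        then have "Y f = (\<Sum>v\<in>S i. real (n v) *\<^sub>R v)"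
          by (simp add: vec_eq_iff Y_def)
        then show ?thesis
          using ideal_power_combination[OF ideal[OF i] S(1)[OF i] S(2)[OF i], of n] m_eq by simp
      qed
      obtain b where b: "exponent_vector b = Y f"
        using ex[OF i0] by blast
      \<comment> \<open>The exponent is determined by \<open>Y f\<close>, which does not depend on
        \<open>i\<close>, so one monomial lies in all the powers.\<close>
      have "monomial b \<in> ideal_power (J i) m" if "i \<in> T" for i
        using ex[OF that] b by (metis exponent_vector_inject)
      then have "monomial b \<in> I m"
        using m1 by (simp add: I)
      then have "Y f \<in> newton_polyhedron (I m)"
        unfolding newton_polyhedron_def b[symmetric] by (intro hull_inc) auto
      then have "(1 / real m) *\<^sub>R Y f \<in> limiting_body I"
        using m1 by (auto simp: limiting_body_def)
      moreover have "Y f = f 1 *\<^sub>R ((1 / real m) *\<^sub>R Y f)"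
        using m m1 by simp
      ultimately show "D f"
        using \<open>0 < f 1\<close> unfolding D_def by blast
    next
      fix f g :: "real \<Rightarrow> real" and a b :: real
      assume D: "D f" "D g" and ab: "0 < a" "0 < b"
      obtain c d where c: "c \<in> limiting_body I" "Y f = f 1 *\<^sub>R c" "0 < f 1"
        and d: "d \<in> limiting_body I" "Y g = g 1 *\<^sub>R d" "0 < g 1"
        using D by (auto simp: D_def)
      \<comment> \<open>The height of the combined map, its value at \<open>1\<close>; dividing by
        it turns the positive combination into a convex one.\<close>
      define t where "t = a * f 1 + b * g 1"
      have t: "0 < t"
        using ab c(3) d(3) by (simp add: t_def add_pos_pos)
      let ?e = "(a * f 1 / t) *\<^sub>R c + (b * g 1 / t) *\<^sub>R d"
      have "?e \<in> limiting_body I"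
      proof (rule convexD[OF convex_limiting_body[OF graded] c(1) d(1)])
        show "a * f 1 / t + b * g 1 / t = 1"
          using t by (simp add: t_def flip: add_divide_distrib)
      qed (use ab c(3) d(3) t in auto)
      moreover have "Y (\<lambda>x. a * f x + b * g x) = t *\<^sub>R ?e"
      proof -
        have "Y (\<lambda>x. a * f x + b * g x) = a *\<^sub>R Y f + b *\<^sub>R Y g"
          by (simp add: Y_def vec_eq_iff)
        also have "\<dots> = t *\<^sub>R ?e"
          using t by (simp add: c(2) d(2) scaleR_add_right)
        finally show ?thesis .
      qed
      ultimately show "D (\<lambda>x. a * f x + b * g x)"
        using t unfolding D_def t_def by blast
    qed
    then obtain g where g: "D g" "\<And>x. x \<in> V \<Longrightarrow> g x = x"
      by blast
    have "g 1 = 1" "Y g = y"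
      using g(2) by (auto simp: V_def Y_def vec_eq_iff)
    then show "y \<in> limiting_body I"
      using g(1) by (auto simp: D_def)
  qed
qed

theorem theorem3p15:
  fixes J :: "nat \<Rightarrow> ('n::finite, 'k::field) mpoly set"
    and I :: "nat \<Rightarrow> ('n, 'k) mpoly set"
    and s :: nat
  assumes "s \<ge> 1"
    and "\<And>i. i \<in> {1..s} \<Longrightarrow> monomial_ideal (J i)"
    and "\<And>m. m \<ge> 1 \<Longrightarrow> I m = (\<Inter>i\<in>{1..s}. ideal_power (J i) m)"
  shows "graded_family I \<and>
    polyhedron (limiting_body I) \<and>
    limiting_body I = (\<Inter>i\<in>{1..s}. newton_polyhedron (J i))"
proof (intro conjI)
  have ne: "{1..s} \<noteq> {}"
    using assms(1) by simp
  show "graded_family I"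
    using ne monomial_ideal_imp_ideal[OF assms(2)] assms(3) by (rule graded_family_Inter_powers)
  show eq: "limiting_body I = (\<Inter>i\<in>{1..s}. newton_polyhedron (J i))"
    using finite_atLeastAtMost ne assms(2,3) by (rule limiting_body_Inter_powers)
  show "polyhedron (limiting_body I)"
    unfolding eq by (intro polyhedron_Inter) (auto intro!: polyhedron_newton_polyhedron assms(2))
qed

end
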